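(* For any integers $m,n\geq 0$, let $p=m-n+1$. Then $$\sum_{k=0}^{\min\{m,n\}}C_{m+k+1,2k+1}\left(C_{n+k,2k}+C_{n+k+1,2k+2}\right)=C_{m+n+1},$$ $$\sum_{k=0}^{\min\{m,n\}}C_{m+k+1,2k+1}\left(C_{n+k,2k}-C_{n+k+1,2k+2}\right)=G_{n,m}(p),$$ where $$G_{n,m}(p)=\begin{cases}\sum_{i=0}^{p-1}C_{n+i}C_{m-i}, & \text{if } p\geq 1,\\ 0, & \text{if } p=0,\\ -\sum_{i=1}^{|p|}C_{n-i}C_{m+i}, & \text{if } p\leq -1.\end{cases}$$
   Context: $C_n=\frac{1}{n+1}\binom{2n}{n}$ is the $n$th Catalan number. For integers $n\geq k\geq 0$, $C_{n,k}=\frac{k+1}{n+1}\binom{2n-k}{n}$ (ballot numbers); these are the entries of an infinite lower triangular matrix, so $C_{n,k}=0$ for $k>n$. *)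

theory Defs
  imports Complex_Main
begin

definition catalan :: "nat \<Rightarrow> rat" where
  "catalan n = 1 / (of_nat n + 1) * of_nat ((2 * n) choose n)"

(* Entries of an infinite lower triangular matrix, zero for k > n. The guard is needed: for
   n = 0 < k the subtraction truncates and the closed formula would give a nonzero value. *)
definition ballot :: "nat \<Rightarrow> nat \<Rightarrow> rat" where
  "ballot n k =
     (if k \<le> n then (of_nat k + 1) / (of_nat n + 1) * of_nat ((2 * n - k) choose n) else 0)"

(* Intended for p = m - n + 1, where m - i and n - i below never truncate: i \<le> p - 1 = m - n
   in the first case and i \<le> - p = n - m - 1 in the last. *)
definition G :: "nat \<Rightarrow> nat \<Rightarrow> int \<Rightarrow> rat" where
  "G n m p =
     (if p \<ge> 1 then (\<Sum>i = 0..nat (p - 1). catalan (n + i) * catalan (m - i))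
      else if p = 0 then 0
      else - (\<Sum>i = 1..nat \<bar>p\<bar>. catalan (n - i) * catalan (m + i)))"

end

theory Submission
  imports Defs
begin

text \<open>
  Ballot numbers count walks on the half line \<open>0, 1, 2, \<dots>\<close> with steps \<open>1\<close> and \<open>-1\<close> that start
  at \<open>0\<close>: the number of such walks of length \<open>N\<close> ending at height \<open>h\<close>, written \<open>w\<^sub>N(h)\<close> here, is
  \<open>C\<^bsub>n,k\<^esub>\<close> for \<open>N = 2n - k\<close> and \<open>h = k\<close> (\<open>ballot_eq_walks\<close>). All ballot numbers of the theorem
  thereby become values of the two functions \<open>w\<^sub>2\<^sub>m\<^sub>+\<^sub>1\<close> and \<open>w\<^sub>2\<^sub>n\<close>, and \<open>C\<^sub>n = w\<^sub>2\<^sub>n(0)\<close>.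

  For the first identity, \<open>w\<^sub>2\<^sub>n(2k) + w\<^sub>2\<^sub>n(2k+2) = w\<^sub>2\<^sub>n\<^sub>+\<^sub>1(2k+1)\<close>, so the sum is the inner product of
  \<open>w\<^sub>2\<^sub>m\<^sub>+\<^sub>1\<close> and \<open>w\<^sub>2\<^sub>n\<^sub>+\<^sub>1\<close>. It counts the closed walks of length \<open>2m+2n+2\<close>, cut into two pieces; in
  terms of operators, the map \<open>w\<^sub>N \<mapsto> w\<^bsub>N+1\<^esub>\<close> is self-adjoint, so that all steps can be moved to
  one factor (\<open>sum_walks_product\<close>).

  For the second identity, the sum is the antisymmetric pairing
  \<open>W(M,N) = \<Sum>\<^sub>h w\<^sub>M(h+1) w\<^sub>N(h) - w\<^sub>M(h) w\<^sub>N(h+1)\<close> at \<open>M = 2m+1\<close> and \<open>N = 2n\<close>. On the whole line, moving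
  a step from one argument to the other would leave such a pairing unchanged; on the half line
  the wall at \<open>0\<close> contributes a boundary term, \<open>W(M+1,N) - W(M,N+1) = 2 w\<^sub>M(0) w\<^sub>N(0)\<close>
  (\<open>wronskian_step\<close>). Going from \<open>W(M,N)\<close> to \<open>W(N,M) = -W(M,N)\<close> in this way collects every boundary
  term twice and yields \<open>W(M,N) = \<Sum>\<^sub>i w\<^bsub>N+i\<^esub>(0) w\<^bsub>M-1-i\<^esub>(0)\<close>, the sum over \<open>0 \<le> i < M - N\<close>, when
  \<open>N \<le> M\<close> (\<open>wronskian_closed_form\<close>). Only even lengths contribute, which leaves the convolution of
  Catalan numbers in \<open>G\<close>; its sign for negative \<open>p\<close> is the antisymmetry of \<open>W\<close>.
\<close>

section \<open>Nonnegative walks and ballot numbers\<close>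

fun walks :: "nat \<Rightarrow> nat \<Rightarrow> rat" where
  "walks 0 h = (if h = 0 then 1 else 0)"
| "walks (Suc N) 0 = walks N 1"
| "walks (Suc N) (Suc h) = walks N h + walks N (Suc (Suc h))"

lemma walks_eq_0_high: "N < h \<Longrightarrow> walks N h = 0"
  by (induction N h rule: walks.induct) auto

lemma walks_eq_0_parity: "odd (N + h) \<Longrightarrow> walks N h = 0"
  by (induction N h rule: walks.induct) (auto simp: odd_pos)

lemma walks_diag: "walks h h = 1"
  by (induction h) (auto simp: walks_eq_0_high)

text \<open>
  The reflection principle: among the unrestricted walks of length \<open>N\<close> from \<open>0\<close> to \<open>k\<close>, those that visit \<open>-1\<close>
  correspond to the unrestricted walks from \<open>-2\<close> to \<open>k\<close>, which have one more step up. The formal proof checks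
  instead that the difference of binomial coefficients satisfies the recursion of \<open>walks\<close>; the
  number of down-steps \<open>Suc d\<close> is positive, so that no binomial coefficient with lower index \<open>-1\<close> occurs.
\<close>

lemma walks_reflection:
  "walks (k + 2 * Suc d) k =
     of_nat ((k + 2 * Suc d) choose Suc d) - of_nat ((k + 2 * Suc d) choose d)"
proof (induction d arbitrary: k)
  case 0
  show ?case
  proof (induction k)
    case 0
    show ?case by (simp add: numeral_2_eq_2)
  next
    case (Suc k)
    then show ?case using walks_diag[of "Suc (Suc k)"] by simp
  qed
next
  case (Suc d)
  note IH = Suc.IH
  show ?case
  proof (induction k)
    case 0
    \<comment> \<open>At the wall, the symmetry of the middle binomial coefficients makes up for the missing
      downward neighbour.\<close>
    have "walks (0 + 2 * Suc (Suc d)) 0 = walks (1 + 2 * Suc d) 1" by simp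
    moreover have "(2 * d + 3) choose Suc (Suc d) = (2 * d + 3) choose Suc d"
      by (subst binomial_symmetric) auto
    ultimately show ?case
      unfolding IH by (simp add: eval_nat_numeral)
  next
    case (Suc k)
    have "walks (Suc k + 2 * Suc (Suc d)) (Suc k)
        = walks (k + 2 * Suc (Suc d)) k + walks (Suc (Suc k) + 2 * Suc d) (Suc (Suc k))"
      by simp
    then show ?case
      unfolding IH Suc.IH by simp
  qed
qed

text \<open>
  With \<open>k\<close> as final height and \<open>n\<close> as number of up-steps, a walk has \<open>n - k\<close> down-steps. For \<open>k > n\<close>
  both sides vanish, as the height then exceeds the length even if \<open>2 * n - k\<close> truncates.
\<close>

lemma ballot_eq_walks: "ballot n k = walks (2 * n - k) k"
proof (cases "k \<le> n")
  case False
  then show ?thesis by (auto simp: ballot_def walks_eq_0_high)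
next
  case True
  then obtain e where n: "n = k + e" using le_iff_add by blast
  show ?thesis
  proof (cases e)
    case 0
    then show ?thesis by (simp add: n ballot_def walks_diag)
  next
    case (Suc d)
    let ?N = "k + 2 * Suc d"
    define a b :: rat where "a = of_nat (?N choose Suc d)" and "b = of_nat (?N choose d)"
    have "(?N choose n) = (?N choose Suc d)"
      by (subst binomial_symmetric) (auto simp: n Suc)
    then have ballot: "ballot n k = (of_nat k + 1) / (of_nat k + of_nat d + 2) * a"
      by (simp add: ballot_def n Suc a_def algebra_simps del: binomial_Suc_Suc)
    have "Suc d * (?N choose Suc d) = (k + d + 2) * (?N choose d)"
    proof -
      have "k + d + 2 = ?N - d" by simp
      then show ?thesis
        by (simp only: binomial_absorb_comp binomial_absorption)
    qed
    then have "(of_nat d + 1) * a = (of_nat k + of_nat d + 2) * b"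
      unfolding a_def b_def
      by (metis (no_types, lifting) of_nat_Suc of_nat_add of_nat_mult of_nat_numeral add.commute)
    then have "(of_nat k + 1) * a = (of_nat k + of_nat d + 2) * (a - b)"
      by (simp add: algebra_simps)
    moreover have "of_nat k + of_nat d + 2 \<noteq> (0 :: rat)"
      by (metis of_nat_add of_nat_numeral of_nat_eq_0_iff add_is_0 zero_neq_numeral)
    ultimately have "ballot n k = a - b"
      by (simp add: ballot field_simps)
    also have "\<dots> = walks ?N k"
      by (simp only: walks_reflection a_def b_def)
    also have "?N = 2 * n - k" by (simp add: n Suc)
    finally show ?thesis .
  qed
qed

lemma walks_return: "walks (2 * n) 0 = catalan n"
  using ballot_eq_walks[of n 0] by (simp add: ballot_def catalan_def)

section \<open>The step operator is self-adjoint\<close>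

text \<open>
  Green's formula for the step operator, summation by parts on the heights up to \<open>K\<close>. The wall at
  \<open>0\<close> contributes nothing, and the boundary term at the top vanishes once \<open>K\<close> exceeds the lengths.
\<close>

lemma sum_walks_step_adjoint:
  "(\<Sum>h\<le>K. walks (Suc M) h * walks N h) - (\<Sum>h\<le>K. walks M h * walks (Suc N) h)
     = walks M (Suc K) * walks N K - walks M K * walks N (Suc K)"
  by (induction K) (auto simp: algebra_simps)

lemma sum_walks_product:
  assumes "M + N \<le> K"
  shows "(\<Sum>h\<le>K. walks M h * walks N h) = walks (M + N) 0"
  using assms
proof (induction M arbitrary: N)
  case 0
  have "(\<Sum>h\<le>K. walks 0 h * walks N h) = (\<Sum>h\<le>K. if h = 0 then walks N 0 else 0)"
    by (intro sum.cong) auto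
  then show ?case by simp
next
  case (Suc M)
  have "(\<Sum>h\<le>K. walks (Suc M) h * walks N h) = (\<Sum>h\<le>K. walks M h * walks (Suc N) h)"
    using sum_walks_step_adjoint[where K = K and M = M and N = N] Suc.prems
    by (simp add: walks_eq_0_high)
  then show ?case using Suc by simp
qed

section \<open>The antisymmetric pairing\<close>

text \<open>
  The sum over all heights of the Wronskian (Casoratian) determinants of \<open>walks M\<close> and \<open>walks N\<close>. The
  cutoff \<open>K\<close> keeps the sum finite; for \<open>K\<close> at least \<open>M\<close> and \<open>N\<close> it has no effect on the value.
\<close>

definition wronskian :: "nat \<Rightarrow> nat \<Rightarrow> nat \<Rightarrow> rat" where
  "wronskian K M N =
     (\<Sum>h\<le>K. walks M (Suc h) * walks N h - walks M h * walks N (Suc h))"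

lemma wronskian_antisym: "wronskian K N M = - wronskian K M N"
  unfolding wronskian_def by (simp add: sum_negf[symmetric] mult.commute)

text \<open>
  The difference of the two summands at \<open>h\<close> is \<open>V h - V (h + 1)\<close> for
  \<open>V h = 2 f(h) g(h) - f(h+1) g(h-1) - f(h-1) g(h+1)\<close>, where \<open>f\<close> and \<open>g\<close> are \<open>walks M\<close> and \<open>walks N\<close>
  with value \<open>0\<close> at height \<open>-1\<close>. The sum telescopes to \<open>V 0 - V (K + 1)\<close>, and \<open>V 0 = 2 f(0) g(0)\<close> is
  what the wall leaves behind.
\<close>

lemma wronskian_step_boundary:
  "wronskian K (Suc M) N - wronskian K M (Suc N) = 2 * walks M 0 * walks N 0
     + walks M (Suc (Suc K)) * walks N K + walks M K * walks N (Suc (Suc K))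
     - 2 * walks M (Suc K) * walks N (Suc K)"
  unfolding wronskian_def by (induction K) (auto simp: algebra_simps)

lemma wronskian_step:
  assumes "M + N < K"
  shows "wronskian K (Suc M) N = wronskian K M (Suc N) + 2 * walks M 0 * walks N 0"
  using wronskian_step_boundary[of K M N] assms by (simp add: walks_eq_0_high)

lemma wronskian_shift:
  assumes "M + N + d < K"
  shows "wronskian K (M + d) N
       = wronskian K M (N + d) + 2 * (\<Sum>i<d. walks (N + i) 0 * walks (M + d - Suc i) 0)"
  using assms
proof (induction d arbitrary: N)
  case 0
  then show ?case by simp
next
  case (Suc d)
  have "wronskian K (M + Suc d) N
      = wronskian K (M + d) (Suc N) + 2 * walks N 0 * walks (M + d) 0"
    using wronskian_step[of "M + d" N K] Suc.prems by simp
  also have "wronskian K (M + d) (Suc N) = wronskian K M (N + Suc d)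
      + 2 * (\<Sum>i<d. walks (Suc N + i) 0 * walks (M + d - Suc i) 0)"
    using Suc by simp
  finally show ?case by (simp add: sum.lessThan_Suc_shift algebra_simps del: sum.lessThan_Suc)
qed

text \<open>
  Shifting all \<open>d\<close> surplus steps to the other argument swaps the two lengths, which by antisymmetry
  changes the sign. So twice the pairing is twice the sum of the boundary terms.
\<close>

lemma wronskian_closed_form:
  assumes "2 * N + d < K"
  shows "wronskian K (N + d) N = (\<Sum>i<d. walks (N + i) 0 * walks (N + d - Suc i) 0)"
  using wronskian_shift[of N N d K] wronskian_antisym[of K N "N + d"] assms by simp

section \<open>Restriction to one parity class\<close>

lemma sum_split_parity: "(\<Sum>h<2 * K. f h) = (\<Sum>k<K. f (2 * k) + f (Suc (2 * k)))"
  for f :: "nat \<Rightarrow> 'a::comm_monoid_add"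
  by (induction K) (auto simp: add.assoc)

lemma sum_walks_product_odd:
  assumes "m + n < K"
  shows "(\<Sum>k<K. walks (2 * m + 1) (2 * k + 1) * walks (2 * n + 1) (2 * k + 1)) = catalan (m + n + 1)"
proof -
  have "(\<Sum>k<K. walks (2 * m + 1) (2 * k + 1) * walks (2 * n + 1) (2 * k + 1))
      = (\<Sum>h<2 * Suc K. walks (2 * m + 1) h * walks (2 * n + 1) h)"
    using assms by (subst sum_split_parity) (simp add: walks_eq_0_parity walks_eq_0_high)
  also have "\<dots> = walks (2 * m + 1 + (2 * n + 1)) 0"
    using sum_walks_product[of "2 * m + 1" "2 * n + 1" "2 * K + 1"] assms
    by (simp flip: lessThan_Suc_atMost)
  also have "\<dots> = catalan (m + n + 1)"
    using walks_return[of "m + n + 1"] by (simp add: algebra_simps)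
  finally show ?thesis .
qed

text \<open>
  An even height \<open>h\<close> only sees the first product of the pairing and an odd height only the second, by
  parity; the summand for \<open>k\<close> on the left joins the heights \<open>2 * k\<close> and \<open>2 * k + 1\<close>.
\<close>

lemma wronskian_odd_even:
  "(\<Sum>k<Suc K. walks (2 * m + 1) (2 * k + 1) * (walks (2 * n) (2 * k) - walks (2 * n) (2 * k + 2)))
     = wronskian (2 * K + 1) (2 * m + 1) (2 * n)"
proof -
  have "{..2 * K + 1} = {..<2 * Suc K}" by auto
  then show ?thesis
    unfolding wronskian_def
    by (simp only: sum_split_parity, intro sum.cong) (auto simp: walks_eq_0_parity algebra_simps)
qed

text \<open>
  In the closed form, a factor \<open>walks i 0\<close> with odd \<open>i\<close> is zero. If \<open>n \<le> m\<close>, the surviving indices are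
  the even ones; otherwise the smaller length \<open>2 * m + 1\<close> is odd, and the odd ones survive.
\<close>

lemma wronskian_eq_G:
  assumes "2 * (m + n) + 2 < K" and p: "p = int m - int n + 1"
  shows "wronskian K (2 * m + 1) (2 * n) = G n m p"
proof (cases "n \<le> m")
  case True
  define q where "q = m - n"
  have m: "m = n + q" using True by (simp add: q_def)
  let ?f = "\<lambda>i. walks (2 * n + i) 0 * walks (2 * n + (2 * q + 1) - Suc i) 0"
  \<comment> \<open>The closed form has the odd number \<open>2 * q + 1\<close> of terms; the vanishing term \<open>i = 2 * q + 1\<close> is
    added so that they can be paired off.\<close>
  have "wronskian K (2 * m + 1) (2 * n) = (\<Sum>i<2 * Suc q. ?f i)"
    using wronskian_closed_form[of "2 * n" "2 * q + 1" K] assms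
    by (simp add: m algebra_simps walks_eq_0_parity)
  also have "\<dots> = (\<Sum>k<Suc q. catalan (n + k) * catalan (m - k))"
    unfolding sum_split_parity
  proof (intro sum.cong refl)
    fix k assume "k \<in> {..<Suc q}"
    then have "2 * n + (2 * q + 1) - Suc (2 * k) = 2 * (m - k)" by (auto simp: m)
    then show "?f (2 * k) + ?f (Suc (2 * k)) = catalan (n + k) * catalan (m - k)"
      using walks_return[of "n + k"] walks_return[of "m - k"]
      by (simp add: walks_eq_0_parity)
  qed
  also have "\<dots> = G n m p"
    by (simp add: G_def p m lessThan_Suc_atMost atMost_atLeast0)
  finally show ?thesis .
next
  case False
  define q where "q = n - Suc m"
  have n: "n = Suc (m + q)" using False by (simp add: q_def)
  let ?f = "\<lambda>i. walks (2 * m + 1 + i) 0 * walks (2 * m + 1 + (2 * q + 1) - Suc i) 0"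
  have "wronskian K (2 * m + 1) (2 * n) = - (\<Sum>i<Suc (2 * q). ?f i)"
    using wronskian_closed_form[of "2 * m + 1" "2 * q + 1" K] assms
      wronskian_antisym[of K "2 * n" "2 * m + 1"]
    by (simp add: n algebra_simps)
  \<comment> \<open>Here the last of the \<open>2 * q + 1\<close> terms vanishes and is dropped.\<close>
  also have "(\<Sum>i<Suc (2 * q). ?f i) = (\<Sum>i<2 * q. ?f i)"
    by (simp add: walks_eq_0_parity)
  also have "\<dots> = (\<Sum>k<q. catalan (n - Suc k) * catalan (m + Suc k))"
    unfolding sum_split_parity
  proof (intro sum.cong refl)
    fix k assume "k \<in> {..<q}"
    then have "2 * m + 1 + (2 * q + 1) - Suc (Suc (2 * k)) = 2 * (n - Suc k)"
      by (auto simp: n)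
    then show "?f (2 * k) + ?f (Suc (2 * k)) = catalan (n - Suc k) * catalan (m + Suc k)"
      using walks_return[of "m + Suc k"] walks_return[of "n - Suc k"]
      by (simp add: walks_eq_0_parity)
  qed
  also have "\<dots> = (\<Sum>i = 1..q. catalan (n - i) * catalan (m + i))"
    by (intro sum.reindex_bij_witness[of _ "\<lambda>i. i - 1" Suc]) auto
  also have "- \<dots> = G n m p"
    by (simp add: G_def p n)
  finally show ?thesis .
qed

theorem theorem3p1:
  fixes m n :: nat and p :: int
  assumes "p = int m - int n + 1"
  shows "(\<Sum>k = 0..min m n. ballot (m + k + 1) (2 * k + 1) *
            (ballot (n + k) (2 * k) + ballot (n + k + 1) (2 * k + 2))) = catalan (m + n + 1)
       \<and> (\<Sum>k = 0..min m n. ballot (m + k + 1) (2 * k + 1) *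
            (ballot (n + k) (2 * k) - ballot (n + k + 1) (2 * k + 2))) = G n m p"
proof -
  define K where "K = m + n + 1"
  have b: "ballot (m + k + 1) (2 * k + 1) = walks (2 * m + 1) (2 * k + 1)"
    "ballot (n + k) (2 * k) = walks (2 * n) (2 * k)"
    "ballot (n + k + 1) (2 * k + 2) = walks (2 * n) (2 * k + 2)" for k
    by (simp_all add: ballot_eq_walks algebra_simps)
  \<comment> \<open>Beyond \<open>min m n\<close> a height exceeds the length of its walk, so the sums may run up to a bound that
    is large enough for all lengths involved.\<close>
  have truncate: "(\<Sum>k = 0..min m n. walks (2 * m + 1) (2 * k + 1) * f k)
      = (\<Sum>k<Suc K. walks (2 * m + 1) (2 * k + 1) * f k)"
    if "\<And>k. n < k \<Longrightarrow> f k = 0" for f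
  proof (intro sum.mono_neutral_left ballI)
    fix k assume "k \<in> {..<Suc K} - {0..min m n}"
    then have "m < k \<or> n < k" by auto
    then show "walks (2 * m + 1) (2 * k + 1) * f k = 0"
      using that by (auto simp: walks_eq_0_high simp del: walks.simps)
  qed (auto simp: K_def)
  have "(\<Sum>k = 0..min m n. walks (2 * m + 1) (2 * k + 1) *
      (walks (2 * n) (2 * k) + walks (2 * n) (2 * k + 2))) = catalan (m + n + 1)"
    using sum_walks_product_odd[of m n "Suc K"]
    by (subst truncate) (simp_all add: walks_eq_0_high K_def)
  moreover have "(\<Sum>k = 0..min m n. walks (2 * m + 1) (2 * k + 1) *
      (walks (2 * n) (2 * k) - walks (2 * n) (2 * k + 2))) = G n m p"
  proof (subst truncate)
    show "(\<Sum>k<Suc K. walks (2 * m + 1) (2 * k + 1) *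
        (walks (2 * n) (2 * k) - walks (2 * n) (2 * k + 2))) = G n m p"
      unfolding wronskian_odd_even by (rule wronskian_eq_G[OF _ assms]) (simp add: K_def)
  qed (simp add: walks_eq_0_high)
  ultimately show ?thesis
    unfolding b by blast
qed

end
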